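(* Let $(I,\preceq)$ be a partially ordered set and let $G=(I,E)$ be its digraph, $E=\{(i,j)\in I\times I: j\prec i\}$. Let $(\mathcal{A},\varphi)$ be a non-commutative probability space and $(\mathcal{A}_i)_{i\in I}$ a family of subalgebras of $\mathcal{A}$. Then $(\mathcal{A}_i)_{i\in I}$ is BMT independent with respect to $(\varphi,G)$ if and only if it is weak BM independent with respect to $\preceq$.
   Context: A non-commutative probability space is a pair $(\mathcal{A},\varphi)$ with $\mathcal{A}$ a complex unital algebra and $\varphi:\mathcal{A}\to\mathbb{C}$ linear with $\varphi(1)=1$. Subalgebras need not be unital. $i\prec j$ means $i\preceq j$ and $i\ne j$; $i\nsim j$ means that $i$ and $j$ are incomparable. $[m]=\{1,\dots,m\}$ and $[\ell,m]=\{\ell,\dots,m\}$. For a digraph $G=(I,E)$ and $\mathbf{i}=(i_1,\dots,i_m)$ with $i_k\in I$, $\ker_G[\mathbf{i}]$ is the partition of $[m]$ given by the equivalence relation: $k\sim k'$ iff $i_k=i_{k'}$ and $(i_\ell,i_k)\in E$ for every $\ell$ strictly between $k$ and $k'$ with $i_\ell\neq i_k$. The family $(\mathcal{A}_i)_{i\in I}$ is BMT independent with respect to $(\varphi,G)$ if for all $m\ge1$ and $a_1\in\mathcal{A}_{i_1},\dots,a_m\in\mathcal{A}_{i_m}$ one has $\varphi(a_1\cdots a_m)=\prod_{B\in\ker_G[\mathbf{i}]}\varphi((a_k)|_B)$, where $(a_k)|_B=a_{k_1}\cdots a_{k_r}$ for $B=\{k_1<\cdots<k_r\}$. A product $a_1\cdots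 a_m$ with $a_k\in\mathcal{A}_{i_k}$ is alternating if $i_1\ne i_2$, $i_2\neq i_3$, ..., $i_{m-1}\ne i_m$. The family $(\mathcal{A}_i)_{i\in I}$ is weak BM independent with respect to $\preceq$ if every alternating product $a_1\cdots a_m$ with $a_k\in\mathcal{A}_{i_k}$ satisfies both: (weak BM1) if $i_{k-1}\prec i_k\succ i_{k+1}$ or $i_{k-1}\nsim i_k\succ i_{k+1}$ or $i_{k-1}\prec i_k\nsim i_{k+1}$ for some $k\in[2,m-1]$, then $\varphi(a_1\cdots a_m)=\varphi(a_k)\,\varphi(a_1\cdots a_{k-1}a_{k+1}\cdots a_m)$; (BM2) if $i_1\succ\cdots\succ i_k\nsim\cdots\nsim i_{k+\ell}\prec\cdots\prec i_m$ for some $k\in[m]$ and $\ell\in[0,m-k]$ (i.e. consecutive indices are strictly decreasing up to position $k$, consecutive ones are incomparable from $k$ to $k+\ell$, and strictly increasing from $k+\ell$ on), then $\varphi(a_1\cdots a_m)=\prod_{j=1}^m\varphi(a_j)$. *)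

theory Defs
  imports Complex_Main
begin

text \<open>
  A complex unital algebra is a unital ring with a compatible complex vector space structure,
  given by an explicit scalar multiplication (the library has no type class for this).
\<close>

locale complex_unital_algebra = vector_space scale
  for scale :: "complex \<Rightarrow> 'a::ring_1 \<Rightarrow> 'a" +
  assumes scale_mult_left: "scale c x * y = scale c (x * y)"
    and scale_mult_right: "x * scale c y = scale c (x * y)"
begin

text \<open>Subalgebras need not contain the unit.\<close>

definition subalgebra :: "'a set \<Rightarrow> bool" where
  "subalgebra S \<longleftrightarrow> subspace S \<and> (\<forall>x\<in>S. \<forall>y\<in>S. x * y \<in> S)"

end

locale nc_prob_space = complex_unital_algebra scale
  for scale :: "complex \<Rightarrow> 'a::ring_1 \<Rightarrow> 'a" +
  fixes \<phi> :: "'a \<Rightarrow> complex"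
  assumes linear_state: "Vector_Spaces.linear scale (*) \<phi>"
    and state_one: "\<phi> 1 = 1"

text \<open>
  Tuples \<open>(a\<^sub>1, \<dots>, a\<^sub>m)\<close> and \<open>(i\<^sub>1, \<dots>, i\<^sub>m)\<close> are functions on \<open>nat\<close>, of which only the
  values on \<open>{1..m}\<close> matter.  Products are taken in increasing order of the positions.
\<close>

definition ordered_prod :: "(nat \<Rightarrow> 'a::monoid_mult) \<Rightarrow> nat set \<Rightarrow> 'a" where
  "ordered_prod a B = prod_list (map a (sorted_list_of_set B))"

definition ker_rel :: "('i \<times> 'i) set \<Rightarrow> (nat \<Rightarrow> 'i) \<Rightarrow> nat \<Rightarrow> (nat \<times> nat) set" where
  "ker_rel E i m = {(k, k'). k \<in> {1..m} \<and> k' \<in> {1..m} \<and> i k = i k' \<and>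
     (\<forall>l. min k k' < l \<and> l < max k k' \<and> i l \<noteq> i k \<longrightarrow> (i l, i k) \<in> E)}"

lemma equiv_ker_rel: "equiv {1..m} (ker_rel E i m)"
proof (rule equivI)
  show "ker_rel E i m \<subseteq> {1..m} \<times> {1..m}"
    by (auto simp: ker_rel_def)
  show "refl_on {1..m} (ker_rel E i m)"
    by (auto simp: ker_rel_def refl_on_def)
  show "sym (ker_rel E i m)"
    by (auto simp: ker_rel_def sym_def min.commute max.commute)
  show "trans (ker_rel E i m)"
  proof (rule transI)
    fix x y z assume xy: "(x, y) \<in> ker_rel E i m" and yz: "(y, z) \<in> ker_rel E i m"
    have "(i l, i x) \<in> E" if "min x z < l" "l < max x z" "i l \<noteq> i x" for l
    proof -
      have "l \<noteq> y" using that xy by (auto simp: ker_rel_def)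
      then have "min x y < l \<and> l < max x y \<or> min y z < l \<and> l < max y z"
        using that by linarith
      then show ?thesis using that xy yz by (auto simp: ker_rel_def)
    qed
    then show "(x, z) \<in> ker_rel E i m" using xy yz by (auto simp: ker_rel_def)
  qed
qed

definition ker_partition :: "('i \<times> 'i) set \<Rightarrow> (nat \<Rightarrow> 'i) \<Rightarrow> nat \<Rightarrow> nat set set" where
  "ker_partition E i m = {1..m} // ker_rel E i m"

definition BMT_independent ::
    "('a::ring_1 \<Rightarrow> complex) \<Rightarrow> 'i set \<Rightarrow> ('i \<times> 'i) set \<Rightarrow> ('i \<Rightarrow> 'a set) \<Rightarrow> bool" where
  "BMT_independent \<phi> I E A \<longleftrightarrow>
     (\<forall>m i a. m \<ge> 1 \<and> (\<forall>k\<in>{1..m}. i k \<in> I \<and> a k \<in> A (i k)) \<longrightarrow>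
        \<phi> (ordered_prod a {1..m}) = (\<Prod>B\<in>ker_partition E i m. \<phi> (ordered_prod a B)))"

text \<open>
  A partial order on \<open>I\<close> is given by its graph \<open>r\<close>, with \<open>(i, j) \<in> r\<close> meaning \<open>i \<preceq> j\<close>.
\<close>

definition prec :: "('i \<times> 'i) set \<Rightarrow> 'i \<Rightarrow> 'i \<Rightarrow> bool" where
  "prec r i j \<longleftrightarrow> (i, j) \<in> r \<and> i \<noteq> j"

definition incomparable :: "('i \<times> 'i) set \<Rightarrow> 'i \<Rightarrow> 'i \<Rightarrow> bool" where
  "incomparable r i j \<longleftrightarrow> (i, j) \<notin> r \<and> (j, i) \<notin> r"

definition order_digraph :: "'i set \<Rightarrow> ('i \<times> 'i) set \<Rightarrow> ('i \<times> 'i) set" where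
  "order_digraph I r = {(i, j). i \<in> I \<and> j \<in> I \<and> prec r j i}"

definition alternating :: "(nat \<Rightarrow> 'i) \<Rightarrow> nat \<Rightarrow> bool" where
  "alternating i m \<longleftrightarrow> (\<forall>k\<in>{1..<m}. i k \<noteq> i (Suc k))"

definition weak_BM1 ::
    "('a::ring_1 \<Rightarrow> complex) \<Rightarrow> ('i \<times> 'i) set \<Rightarrow> nat \<Rightarrow> (nat \<Rightarrow> 'i) \<Rightarrow> (nat \<Rightarrow> 'a) \<Rightarrow> bool" where
  "weak_BM1 \<phi> r m i a \<longleftrightarrow>
     (\<forall>k\<in>{2..m - 1}.
        prec r (i (k - 1)) (i k) \<and> prec r (i (k + 1)) (i k) \<or>
        incomparable r (i (k - 1)) (i k) \<and> prec r (i (k + 1)) (i k) \<or>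
        prec r (i (k - 1)) (i k) \<and> incomparable r (i k) (i (k + 1)) \<longrightarrow>
        \<phi> (ordered_prod a {1..m}) = \<phi> (a k) * \<phi> (ordered_prod a ({1..m} - {k})))"

definition BM2 ::
    "('a::ring_1 \<Rightarrow> complex) \<Rightarrow> ('i \<times> 'i) set \<Rightarrow> nat \<Rightarrow> (nat \<Rightarrow> 'i) \<Rightarrow> (nat \<Rightarrow> 'a) \<Rightarrow> bool" where
  "BM2 \<phi> r m i a \<longleftrightarrow>
     ((\<exists>k\<in>{1..m}. \<exists>l\<in>{0..m - k}.
         (\<forall>j\<in>{1..<k}. prec r (i (j + 1)) (i j)) \<and>
         (\<forall>j\<in>{k..<k + l}. incomparable r (i j) (i (j + 1))) \<and>
         (\<forall>j\<in>{k + l..<m}. prec r (i j) (i (j + 1)))) \<longrightarrow>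
      \<phi> (ordered_prod a {1..m}) = (\<Prod>j\<in>{1..m}. \<phi> (a j)))"

definition weak_BM_independent ::
    "('a::ring_1 \<Rightarrow> complex) \<Rightarrow> 'i set \<Rightarrow> ('i \<times> 'i) set \<Rightarrow> ('i \<Rightarrow> 'a set) \<Rightarrow> bool" where
  "weak_BM_independent \<phi> I r A \<longleftrightarrow>
     (\<forall>m i a. m \<ge> 1 \<and> (\<forall>k\<in>{1..m}. i k \<in> I \<and> a k \<in> A (i k)) \<and> alternating i m \<longrightarrow>
        weak_BM1 \<phi> r m i a \<and> BM2 \<phi> r m i a)"

end

theory Submission
  imports Defs
begin

text \<open>
  Both conditions are statements about the kernel partition.  A position that is a strict local
  maximum in the sense of (weak BM1) is a singleton block, and deleting it changes no other block;
  for the index sequences of (BM2) all blocks are singletons.  Conversely, merging equal neighbours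
  does not affect the kernel partition, and an alternating sequence without a position as in
  (weak BM1) descends, then moves between incomparable indices, then ascends, so it is covered by
  (BM2).  Induction on the length gives the factorization.
\<close>

section \<open>Ordered products\<close>

lemma ordered_prod_empty [simp]: "ordered_prod a {} = 1"
  by (simp add: ordered_prod_def)

lemma ordered_prod_singleton [simp]: "ordered_prod a {x} = a x"
  by (simp add: ordered_prod_def)

lemma ordered_prod_Un:
  assumes "finite S" "finite T" "\<And>x y. x \<in> S \<Longrightarrow> y \<in> T \<Longrightarrow> x < y"
  shows "ordered_prod a (S \<union> T) = ordered_prod a S * ordered_prod a T"
proof -
  have "sorted_list_of_set (S \<union> T) = sorted_list_of_set S @ sorted_list_of_set T"
  proof (rule sorted_distinct_set_unique)
    show "sorted (sorted_list_of_set S @ sorted_list_of_set T)"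
      using assms by (auto simp: sorted_append intro: less_imp_le)
    show "distinct (sorted_list_of_set S @ sorted_list_of_set T)"
      using assms by fastforce
  qed (use assms in auto)
  then show ?thesis
    by (simp add: ordered_prod_def)
qed

lemma ordered_prod_cong:
  assumes "finite S" "\<And>x. x \<in> S \<Longrightarrow> a x = b x"
  shows "ordered_prod a S = ordered_prod b S"
  using assms by (auto simp: ordered_prod_def intro!: arg_cong[where f = prod_list])

text \<open>Monotonicity places the fibre over a smaller value wholly to the left of the fibre over
  a larger one, so the induction adds the largest value of \<open>C\<close> and appends its fibre on
  the right. A value that \<open>p\<close> does not attain has an empty fibre and contributes
  1.\<close>

lemma ordered_prod_fibres:
  assumes S: "finite S" and p: "mono_on S p" and C: "finite C"
  shows "ordered_prod a {x \<in> S. p x \<in> C} = ordered_prod (\<lambda>y. ordered_prod a {x \<in> S. p x = y}) C"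
  using C
proof (induction C rule: finite_linorder_max_induct)
  case empty
  then show ?case by simp
next
  case (insert c C)
  have split: "{x \<in> S. p x \<in> insert c C} = {x \<in> S. p x \<in> C} \<union> {x \<in> S. p x = c}"
    by auto
  have less: "x < y" if "x \<in> {x \<in> S. p x \<in> C}" "y \<in> {x \<in> S. p x = c}" for x y
  proof (rule ccontr)
    assume "\<not> x < y"
    then have "p y \<le> p x"
      using that by (intro mono_onD[OF p]) auto
    then show False
      using that insert.hyps by fastforce
  qed
  have "ordered_prod b (insert c C) = ordered_prod b C * b c" for b :: "nat \<Rightarrow> 'a"
    using ordered_prod_Un[of C "{c}" b] insert.hyps by simp
  then show ?case
    unfolding split using S insert.IH less by (subst ordered_prod_Un) auto
qed

section \<open>Kernels on arbitrary sets of positions\<close>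

text \<open>Intermediate positions range over \<open>S\<close> only, so a deleted position imposes
  no condition, and the kernel of a shortened word can be compared with the original one without
  renumbering.\<close>

definition ker_rel_on :: "('i \<times> 'i) set \<Rightarrow> (nat \<Rightarrow> 'i) \<Rightarrow> nat set \<Rightarrow> (nat \<times> nat) set" where
  "ker_rel_on E i S = {(k, k'). k \<in> S \<and> k' \<in> S \<and> i k = i k' \<and>
     (\<forall>l\<in>S. min k k' < l \<and> l < max k k' \<and> i l \<noteq> i k \<longrightarrow> (i l, i k) \<in> E)}"

lemma ker_rel_on_refl [simp]: "(x, x) \<in> ker_rel_on E i S \<longleftrightarrow> x \<in> S"
  by (auto simp: ker_rel_on_def)

lemma ker_rel_on_sym: "(x, y) \<in> ker_rel_on E i S \<Longrightarrow> (y, x) \<in> ker_rel_on E i S"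
  by (auto simp: ker_rel_on_def min.commute max.commute)

lemma ker_partition_eq: "ker_partition E i m = {1..m} // ker_rel_on E i {1..m}"
proof -
  have "ker_rel E i m = ker_rel_on E i {1..m}"
    by (fastforce simp: ker_rel_def ker_rel_on_def)
  then show ?thesis
    by (simp add: ker_partition_def)
qed

definition factorizes ::
    "('a::ring_1 \<Rightarrow> complex) \<Rightarrow> ('i \<times> 'i) set \<Rightarrow> (nat \<Rightarrow> 'i) \<Rightarrow> (nat \<Rightarrow> 'a) \<Rightarrow> nat set \<Rightarrow> bool" where
  "factorizes \<phi> E i a S \<longleftrightarrow>
     \<phi> (ordered_prod a S) = (\<Prod>B\<in>S // ker_rel_on E i S. \<phi> (ordered_prod a B))"

lemma BMT_independent_iff_factorizes:
  "BMT_independent \<phi> I E A \<longleftrightarrow>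
     (\<forall>m i a. m \<ge> 1 \<and> (\<forall>k\<in>{1..m}. i k \<in> I \<and> a k \<in> A (i k)) \<longrightarrow> factorizes \<phi> E i a {1..m})"
  by (simp add: BMT_independent_def factorizes_def ker_partition_eq)

text \<open>A monotone \<open>p\<close> reflects strict inequalities, which gives one direction.
  Conversely, a position between \<open>x\<close> and \<open>y\<close> lands weakly between their
  images, and strictly if its index differs from theirs, because indices depend on positions only
  through \<open>p\<close>.\<close>

lemma ker_rel_on_pullback:
  assumes p: "mono_on S p" and ij: "\<And>x. x \<in> S \<Longrightarrow> i x = j (p x)" and x: "x \<in> S" and y: "y \<in> S"
  shows "(x, y) \<in> ker_rel_on E i S \<longleftrightarrow> (p x, p y) \<in> ker_rel_on E j (p ` S)"
proof
  assume R: "(x, y) \<in> ker_rel_on E i S"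
  have "(j (p l), j (p x)) \<in> E"
    if "l \<in> S" "min (p x) (p y) < p l" "p l < max (p x) (p y)" "j (p l) \<noteq> j (p x)" for l
  proof -
    have "u < v" if "u \<in> S" "v \<in> S" "p u < p v" for u v
      using mono_onD[OF p, of v u] that by (meson leD leI)
    then have "min x y < l" "l < max x y"
      using that x y by (auto simp: min_less_iff_disj less_max_iff_disj)
    then show ?thesis
      using R that x ij by (auto simp: ker_rel_on_def)
  qed
  then show "(p x, p y) \<in> ker_rel_on E j (p ` S)"
    using R x y ij by (auto simp: ker_rel_on_def)
next
  assume R: "(p x, p y) \<in> ker_rel_on E j (p ` S)"
  have "(i l, i x) \<in> E" if "l \<in> S" "min x y < l" "l < max x y" "i l \<noteq> i x" for l
  proof -
    have "p l \<noteq> p x" "p l \<noteq> p y"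
      using R that x y ij by (auto simp: ker_rel_on_def)
    moreover have "min (p x) (p y) \<le> p l" "p l \<le> max (p x) (p y)"
      using that x y mono_onD[OF p, of x l] mono_onD[OF p, of y l]
        mono_onD[OF p, of l x] mono_onD[OF p, of l y]
      by (auto simp: min_le_iff_disj le_max_iff_disj min_less_iff_disj less_max_iff_disj)
    ultimately have "min (p x) (p y) < p l" "p l < max (p x) (p y)"
      by linarith+
    then show ?thesis
      using R that x ij by (auto simp: ker_rel_on_def)
  qed
  then show "(x, y) \<in> ker_rel_on E i S"
    using R x y ij by (auto simp: ker_rel_on_def)
qed

text \<open>
  With injective \<open>p\<close> this renumbers the positions; with a non-injective \<open>p\<close> it merges equal
  neighbours.
\<close>

lemma factorizes_pullback:
  assumes S: "finite S" and p: "mono_on S p" and ij: "\<And>x. x \<in> S \<Longrightarrow> i x = j (p x)"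
    and b: "\<And>y. y \<in> p ` S \<Longrightarrow> b y = ordered_prod a {x \<in> S. p x = y}"
  shows "factorizes \<phi> E i a S \<longleftrightarrow> factorizes \<phi> E j b (p ` S)"
proof -
  let ?h = "\<lambda>C. {x \<in> S. p x \<in> C}"
  let ?R = "ker_rel_on E i S" and ?R' = "ker_rel_on E j (p ` S)"
  \<comment> \<open>Applied below both to single blocks and to the whole image of
    \<open>p\<close>.\<close>
  have prod: "ordered_prod a (?h C) = ordered_prod b C" if "C \<subseteq> p ` S" for C
    using ordered_prod_fibres[OF S p, of C a] ordered_prod_cong[of C b] b that S
    by (metis (no_types, lifting) finite_imageI finite_subset subsetD)
  have sub: "C \<subseteq> p ` S" if "C \<in> p ` S // ?R'" for C
    using that by (auto simp: quotient_def ker_rel_on_def)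
  have "?R `` {x} = ?h (?R' `` {p x})" if "x \<in> S" for x
  proof -
    have "?R `` {x} \<subseteq> S"
      by (auto simp: ker_rel_on_def)
    then show ?thesis
      using ker_rel_on_pullback[of S p i j x, OF p ij that] by blast
  qed
  then have "S // ?R = ?h ` (p ` S // ?R')"
    unfolding quotient_def by auto
  \<comment> \<open>All blocks lie in the image of \<open>p\<close>, so taking images under
    \<open>p\<close> recovers a block from its preimage.\<close>
  moreover have "inj_on ?h (p ` S // ?R')"
  proof (rule inj_on_inverseI[where g = "image p"])
    fix C assume "C \<in> p ` S // ?R'"
    then show "p ` ?h C = C"
      using sub[of C] by auto
  qed
  ultimately have "(\<Prod>B\<in>S // ?R. \<phi> (ordered_prod a B)) = (\<Prod>C\<in>p ` S // ?R'. \<phi> (ordered_prod b C))"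
    using prod sub by (simp add: prod.reindex)
  moreover have "ordered_prod a S = ordered_prod b (p ` S)"
    using prod[of "p ` S"] by (simp add: Collect_conj_eq) (metis (no_types, lifting) Collect_mem_eq
        Int_absorb2 image_eqI mem_Collect_eq subsetI)
  ultimately show ?thesis
    by (simp add: factorizes_def)
qed

text \<open>All fibres of \<open>f\<close> are singletons, so the letters are merely
  renumbered.\<close>

lemma factorizes_strict_mono_image:
  assumes S: "finite S" and f: "strict_mono_on S f"
  shows "factorizes \<phi> E (i \<circ> f) (a \<circ> f) S \<longleftrightarrow> factorizes \<phi> E i a (f ` S)"
proof (rule factorizes_pullback[OF S])
  show "mono_on S f"
    using f by (rule strict_mono_on_imp_mono_on)
  fix y assume "y \<in> f ` S"
  then obtain x where x: "x \<in> S" "y = f x"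
    by blast
  then have "{z \<in> S. f z = y} = {x}"
    using strict_mono_on_imp_inj_on[OF f] by (auto dest: inj_onD)
  then show "a y = ordered_prod (a \<circ> f) {z \<in> S. f z = y}"
    using x by simp
qed auto

lemma image_skip:
  assumes "k \<in> {1..Suc n}"
  shows "(\<lambda>j. if j < k then j else Suc j) ` {1..n} = {1..Suc n} - {k}"
proof (rule set_eqI)
  fix x
  show "x \<in> (\<lambda>j. if j < k then j else Suc j) ` {1..n} \<longleftrightarrow> x \<in> {1..Suc n} - {k}"
    using assms by (cases x; cases "x < k") (auto simp: image_iff)
qed

text \<open>Closing the gap at \<open>k\<close> gives a word of length \<open>n\<close>. In one
  direction of the equivalence \<open>fact\<close> comes from BMT independence, in the other from
  the induction hypothesis.\<close>

lemma factorizes_skip: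
  fixes k n :: nat
  assumes k: "k \<in> {1..Suc n}"
    and I: "\<And>x. x \<in> {1..Suc n} \<Longrightarrow> i x \<in> I \<and> a x \<in> A (i x)"
    and fact: "\<And>i a. (\<And>x. x \<in> {1..n} \<Longrightarrow> i x \<in> I \<and> a x \<in> A (i x)) \<Longrightarrow> factorizes \<phi> E i a {1..n}"
  shows "factorizes \<phi> E i a ({1..Suc n} - {k})"
proof -
  let ?s = "\<lambda>j. if j < k then j else Suc j"
  have "factorizes \<phi> E (i \<circ> ?s) (a \<circ> ?s) {1..n}"
    using I by (intro fact) auto
  moreover have "strict_mono_on {1..n} ?s"
    by (auto simp: strict_mono_on_def)
  ultimately show ?thesis
    using factorizes_strict_mono_image[of "{1..n}" ?s \<phi> E i a] image_skip[OF k] by simp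
qed

lemma prod_quotient_ker_Id:
  assumes "ker_rel_on E i S = Id_on S"
  shows "(\<Prod>B\<in>S // ker_rel_on E i S. \<phi> (ordered_prod a B)) = (\<Prod>j\<in>S. \<phi> (a j))"
proof -
  have "S // ker_rel_on E i S = (\<lambda>x. {x}) ` S"
    unfolding assms by (auto simp: quotient_def)
  then show ?thesis
    by (simp add: prod.reindex)
qed

lemma prod_quotient_ker_insert:
  assumes S: "finite S" and k: "k \<in> S"
    and R: "ker_rel_on E i S = insert (k, k) (ker_rel_on E i (S - {k}))"
  shows "(\<Prod>B\<in>S // ker_rel_on E i S. \<phi> (ordered_prod a B)) =
    \<phi> (a k) * (\<Prod>B\<in>(S - {k}) // ker_rel_on E i (S - {k}). \<phi> (ordered_prod a B))"
proof -
  let ?R = "ker_rel_on E i S" and ?R' = "ker_rel_on E i (S - {k})"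
  have R': "?R' \<subseteq> (S - {k}) \<times> (S - {k})"
    by (auto simp: ker_rel_on_def)
  have "?R `` {x} = (if x = k then {k} else ?R' `` {x})" for x
    using R' unfolding R by auto
  then have "S // ?R = insert {k} ((S - {k}) // ?R')"
    using k unfolding quotient_def by (auto split: if_splits)
  \<comment> \<open>Blocks of the smaller kernel avoid \<open>k\<close>, so \<open>{k}\<close>
    contributes a genuinely new factor.\<close>
  moreover have "{k} \<notin> (S - {k}) // ?R'"
    using R' by (auto simp: quotient_def)
  moreover have "finite ((S - {k}) // ?R')"
    using S R' by (intro finite_quotient) auto
  ultimately show ?thesis
    by simp
qed

section \<open>Peaks and valleys\<close>

lemma prec_trans:
  assumes "partial_order_on I r" "prec r x y" "prec r y z"
  shows "prec r x z"
  using assms unfolding prec_def partial_order_on_def preorder_on_def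
  by (metis antisymD transD)

text \<open>For an alternating sequence this is the disjunction of the three cases in (weak BM1).\<close>

definition peak :: "('i \<times> 'i) set \<Rightarrow> (nat \<Rightarrow> 'i) \<Rightarrow> nat \<Rightarrow> bool" where
  "peak r i k \<longleftrightarrow>
     prec r (i (k - 1)) (i k) \<and> prec r (i (k + 1)) (i k) \<or>
     incomparable r (i (k - 1)) (i k) \<and> prec r (i (k + 1)) (i k) \<or>
     prec r (i (k - 1)) (i k) \<and> incomparable r (i k) (i (k + 1))"

text \<open>Each case of \<open>peak\<close> makes either neighbour strictly smaller or
  incomparable; this common consequence of the three cases is what isolates the position.\<close>

lemma peak_not_le:
  assumes "partial_order_on I r" "peak r i k"
  shows "(i k, i (k - 1)) \<notin> r" "(i k, i (k + 1)) \<notin> r"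
  using assms unfolding peak_def prec_def incomparable_def partial_order_on_def
  by (auto dest: antisymD)

lemma ker_rel_on_peak:
  assumes po: "partial_order_on I r" and k: "k \<in> {2..m - 1}"
    and I: "\<And>x. x \<in> {1..m} \<Longrightarrow> i x \<in> I" and peak: "peak r i k"
  shows "ker_rel_on (order_digraph I r) i {1..m} =
    insert (k, k) (ker_rel_on (order_digraph I r) i ({1..m} - {k}))"
proof -
  let ?E = "order_digraph I r"
  have k1: "k - 1 \<in> {1..m}" "k \<in> {1..m}" "k + 1 \<in> {1..m}"
    using k by auto
  have refl: "(i k, i k) \<in> r"
    using po I[OF k1(2)] by (auto simp: partial_order_on_def preorder_on_def refl_on_def)
  note nle = peak_not_le[OF po peak]
  \<comment> \<open>A link from \<open>k\<close> to another position either passes over a neighbour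
    of \<open>k\<close>, whose index would have to be strictly larger, or ends at a neighbour, whose
    index would have to be equal. The peak condition excludes both.\<close>
  have isolated: "y = k" if "(k, y) \<in> ker_rel_on ?E i {1..m}" for y
  proof (rule ccontr)
    assume "y \<noteq> k"
    have nbr: "(i q, i k) \<in> ?E"
      if "min k y < q" "q < max k y" "i q \<noteq> i k" "q \<in> {1..m}" for q
      using \<open>(k, y) \<in> _\<close> that by (auto simp: ker_rel_on_def)
    have iy: "i y = i k"
      using that by (auto simp: ker_rel_on_def)
    consider "y < k - 1" | "y = k - 1" | "y = k + 1" | "k + 1 < y"
      using \<open>y \<noteq> k\<close> by linarith
    then show False
    proof cases
      case 1
      then have "(i (k - 1), i k) \<in> ?E"
        using nle(1) refl k1 by (intro nbr) auto
      then show ?thesis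
        using nle by (simp add: order_digraph_def prec_def)
    next
      case 4
      then have "(i (k + 1), i k) \<in> ?E"
        using nle(2) refl k1 by (intro nbr) auto
      then show ?thesis
        using nle by (simp add: order_digraph_def prec_def)
    qed (use iy nle refl in auto)
  qed
  \<comment> \<open>Deleting \<open>k\<close> creates no new link. If \<open>x\<close> and
    \<open>y\<close> are linked across the gap, each neighbour of \<open>k\<close> is an endpoint or
    lies between them, so its index is \<open>i x\<close> or larger. One neighbour is strictly below
    \<open>i k\<close>, and transitivity gives the edge required at \<open>k\<close>.\<close>
  have above: "(i k, i x) \<in> ?E"
    if R: "(x, y) \<in> ker_rel_on ?E i ({1..m} - {k})" and "min x y < k" "k < max x y" for x y
  proof -
    have q: "i q = i x \<or> prec r (i x) (i q)" if "q = k - 1 \<or> q = k + 1" for q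
    proof (cases "q = x \<or> q = y \<or> i q = i x")
      case True
      then show ?thesis
        using R by (auto simp: ker_rel_on_def)
    next
      case False
      then have "min x y < q" "q < max x y" "q \<in> {1..m} - {k}"
        using that \<open>min x y < k\<close> \<open>k < max x y\<close> k by auto
      then have "(i q, i x) \<in> ?E"
        using R False unfolding ker_rel_on_def by blast
      then show ?thesis
        by (simp add: order_digraph_def)
    qed
    have "prec r (i (k - 1)) (i k) \<or> prec r (i (k + 1)) (i k)"
      using peak by (auto simp: peak_def)
    then have "prec r (i x) (i k)"
      using q[of "k - 1"] q[of "k + 1"] by (metis prec_trans[OF po])
    then show ?thesis
      using R I k1 by (auto simp: order_digraph_def ker_rel_on_def)
  qed
  show ?thesis
  proof (intro equalityI subsetI)
    fix z assume z: "z \<in> ker_rel_on ?E i {1..m}"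
    obtain x y where xy: "z = (x, y)"
      by (cases z)
    show "z \<in> insert (k, k) (ker_rel_on ?E i ({1..m} - {k}))"
    proof (cases "x = k \<or> y = k")
      case True
      then show ?thesis
        using isolated ker_rel_on_sym z xy by blast
    next
      case False
      then show ?thesis
        using z xy by (auto simp: ker_rel_on_def)
    qed
  next
    fix z assume z: "z \<in> insert (k, k) (ker_rel_on ?E i ({1..m} - {k}))"
    obtain x y where xy: "z = (x, y)"
      by (cases z)
    show "z \<in> ker_rel_on ?E i {1..m}"
    proof (cases "z = (k, k)")
      case True
      then show ?thesis
        using k1 by simp
    next
      case False
      then have R: "(x, y) \<in> ker_rel_on ?E i ({1..m} - {k})"
        using z xy by blast
      have "(i l, i x) \<in> ?E"
        if "l \<in> {1..m}" "min x y < l" "l < max x y" "i l \<noteq> i x" for l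
        using R that above[OF R] by (cases "l = k") (auto simp: ker_rel_on_def)
      then show ?thesis
        using R xy by (auto simp: ker_rel_on_def)
    qed
  qed
qed

text \<open>An equivalence, so that (weak BM1) can be read off the factorization in one direction
  and yields the factorization in the other.\<close>

lemma factorizes_peak_iff:
  assumes "partial_order_on I r" "k \<in> {2..m - 1}" "\<And>x. x \<in> {1..m} \<Longrightarrow> i x \<in> I" "peak r i k"
    and "factorizes \<phi> (order_digraph I r) i a ({1..m} - {k})"
  shows "factorizes \<phi> (order_digraph I r) i a {1..m} \<longleftrightarrow>
    \<phi> (ordered_prod a {1..m}) = \<phi> (a k) * \<phi> (ordered_prod a ({1..m} - {k}))"
proof -
  have "k \<in> {1..m}"
    using assms(2) by auto
  then show ?thesis
    using prod_quotient_ker_insert[OF _ _ ker_rel_on_peak[OF assms(1-4)], of \<phi> a] assms(5)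
    by (simp add: factorizes_def)
qed

definition valley :: "('i \<times> 'i) set \<Rightarrow> (nat \<Rightarrow> 'i) \<Rightarrow> nat \<Rightarrow> bool" where
  "valley r i m \<longleftrightarrow> (\<exists>k\<in>{1..m}. \<exists>l\<in>{0..m - k}.
     (\<forall>j\<in>{1..<k}. prec r (i (j + 1)) (i j)) \<and>
     (\<forall>j\<in>{k..<k + l}. incomparable r (i j) (i (j + 1))) \<and>
     (\<forall>j\<in>{k + l..<m}. prec r (i j) (i (j + 1))))"

text \<open>Suppose \<open>x < y\<close> are linked. Alternation and \<open>i x = i y\<close> put
  \<open>x + 1\<close> strictly between them with a different index, so the edge condition makes the
  step from \<open>x\<close> an ascent. In a valley only ascents follow an ascent, so
  \<open>i y\<close> is strictly above \<open>i x\<close>, a contradiction.\<close>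

lemma ker_rel_on_valley:
  assumes po: "partial_order_on I r" and I: "\<And>x. x \<in> {1..m} \<Longrightarrow> i x \<in> I"
    and alt: "alternating i m" and valley: "valley r i m"
  shows "ker_rel_on (order_digraph I r) i {1..m} = Id_on {1..m}"
proof -
  let ?E = "order_digraph I r"
  obtain k l where kl: "k \<in> {1..m}" "l \<in> {0..m - k}"
    and down: "\<And>j. j \<in> {1..<k} \<Longrightarrow> prec r (i (j + 1)) (i j)"
    and flat: "\<And>j. j \<in> {k..<k + l} \<Longrightarrow> incomparable r (i j) (i (j + 1))"
    and up: "\<And>j. j \<in> {k + l..<m} \<Longrightarrow> prec r (i j) (i (j + 1))"
    using valley unfolding valley_def by blast
  have anti: "\<not> prec r y x" if "prec r x y" for x y
    using that po by (auto simp: prec_def partial_order_on_def dest: antisymD)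
  have no: False if R: "(x, y) \<in> ker_rel_on ?E i {1..m}" and "x < y" for x y
  proof -
    have xy: "1 \<le> x" "y \<le> m" "i x = i y"
      using R by (auto simp: ker_rel_on_def)
    have "x \<in> {1..<m}"
      using xy \<open>x < y\<close> by simp
    then have ne: "i (x + 1) \<noteq> i x"
      using alt unfolding alternating_def by fastforce
    then have "x + 1 \<noteq> y"
      using xy(3) by metis
    then have "x + 1 \<in> {1..m}" "min x y < x + 1" "x + 1 < max x y"
      using xy(2) \<open>x < y\<close> by auto
    then have "(i (x + 1), i x) \<in> ?E"
      using R ne unfolding ker_rel_on_def by blast
    then have asc: "prec r (i x) (i (x + 1))"
      by (simp add: order_digraph_def)
    have x: "k + l \<le> x"
    proof (rule ccontr)
      assume "\<not> k + l \<le> x"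
      then consider "x \<in> {1..<k}" | "x \<in> {k..<k + l}"
        using xy by force
      then show False
      proof cases
        case 1
        then show ?thesis
          using down anti asc by blast
      next
        case 2
        then show ?thesis
          using flat[of x] asc by (simp add: incomparable_def prec_def)
      qed
    qed
    have "Suc x \<le> y"
      using \<open>x < y\<close> by simp
    \<comment> \<open>The bound is part of the induction claim because \<open>up\<close> controls
      only the steps before \<open>m\<close>.\<close>
    then have "y \<le> m \<longrightarrow> prec r (i x) (i y)"
    proof (induction y rule: dec_induct)
      case base
      then show ?case
        using asc by simp
    next
      case (step n)
      have "prec r (i n) (i (n + 1))" if "Suc n \<le> m"
        using that step.hyps x by (intro up) simp
      then show ?case
        using step.IH prec_trans[OF po, of "i x" "i n" "i (Suc n)"] by simp
    qed
    then show False
      using xy by (simp add: prec_def)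
  qed
  have "(x, y) \<in> ker_rel_on ?E i {1..m} \<longleftrightarrow> (x, y) \<in> Id_on {1..m}" for x y
  proof (cases x y rule: linorder_cases)
    case equal
    then show ?thesis
      by (simp add: Id_on_iff)
  qed (use no[of x y] no[of y x] ker_rel_on_sym[of x y] in \<open>simp_all add: Id_on_iff, blast+\<close>)
  then show ?thesis
    by auto
qed

lemma factorizes_valley_iff:
  assumes "partial_order_on I r" "\<And>x. x \<in> {1..m} \<Longrightarrow> i x \<in> I" "alternating i m" "valley r i m"
  shows "factorizes \<phi> (order_digraph I r) i a {1..m} \<longleftrightarrow>
    \<phi> (ordered_prod a {1..m}) = (\<Prod>j\<in>{1..m}. \<phi> (a j))"
  by (simp only: factorizes_def prod_quotient_ker_Id[OF ker_rel_on_valley[OF assms], of \<phi> a])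

text \<open>Read the word as a sequence of steps of types \<open>D\<close>, \<open>N\<close> and
  \<open>U\<close>. Without peaks, \<open>U\<close> is never followed by \<open>D\<close> or
  \<open>N\<close>, nor \<open>N\<close> by \<open>D\<close>, so the steps come as all
  \<open>D\<close>, then all \<open>N\<close>, then all \<open>U\<close>.\<close>

lemma no_peak_imp_valley:
  assumes m: "m \<ge> 1" and alt: "alternating i m"
    and no_peak: "\<And>k. k \<in> {2..m - 1} \<Longrightarrow> \<not> peak r i k"
  shows "valley r i m"
proof -
  define D where "D j \<longleftrightarrow> prec r (i (j + 1)) (i j)" for j
  define N where "N j \<longleftrightarrow> incomparable r (i j) (i (j + 1))" for j
  define U where "U j \<longleftrightarrow> prec r (i j) (i (j + 1))" for j
  have cases: "D j \<or> N j \<or> U j" if "1 \<le> j" "j < m" for j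
    using alt that by (auto simp: D_def N_def U_def alternating_def prec_def incomparable_def)
  \<comment> \<open>Steps \<open>j\<close> and \<open>Suc j\<close> meet at position
    \<open>Suc j\<close>, where each forbidden pair is one case of \<open>peak\<close>.\<close>
  have step: "\<not> (U j \<and> D (Suc j))" "\<not> (N j \<and> D (Suc j))" "\<not> (U j \<and> N (Suc j))"
    if "1 \<le> j" "Suc j < m" for j
    using no_peak[of "Suc j"] that by (auto simp: D_def N_def U_def peak_def)
  \<comment> \<open>The position where the descent ends; the alternative \<open>j = m\<close>
    guarantees existence and covers a wholly descending word.\<close>
  define k where "k = (LEAST j. 1 \<le> j \<and> (j = m \<or> \<not> D j))"
  have k: "1 \<le> k" "k = m \<or> \<not> D k"
    using LeastI[of "\<lambda>j. 1 \<le> j \<and> (j = m \<or> \<not> D j)" m] m by (auto simp: k_def)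
  have "k \<le> m"
    using m unfolding k_def by (intro Least_le) simp
  have down: "D j" if "1 \<le> j" "j < k" for j
    using not_less_Least[of j "\<lambda>j. 1 \<le> j \<and> (j = m \<or> \<not> D j)"] that by (auto simp: k_def)
  \<comment> \<open>The end of the flat stretch; \<open>q - k\<close> becomes the \<open>l\<close>
    of \<open>valley\<close>.\<close>
  define q where "q = (LEAST j. k \<le> j \<and> (j = m \<or> \<not> N j))"
  have q: "k \<le> q" "q = m \<or> \<not> N q"
    using LeastI[of "\<lambda>j. k \<le> j \<and> (j = m \<or> \<not> N j)" m] \<open>k \<le> m\<close> by (auto simp: q_def)
  have "q \<le> m"
    using \<open>k \<le> m\<close> unfolding q_def by (intro Least_le) simp
  have flat: "N j" if "k \<le> j" "j < q" for j
    using not_less_Least[of j "\<lambda>j. k \<le> j \<and> (j = m \<or> \<not> N j)"] that by (auto simp: q_def)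
  have "j < m \<longrightarrow> U j" if "q \<le> j" for j
    using that
  proof (induction j rule: dec_induct)
    case base
    show ?case
    proof
      assume "q < m"
      \<comment> \<open>For \<open>q = k\<close> this is the choice of \<open>k\<close>; otherwise
        the step before \<open>q\<close> is of type \<open>N\<close>, which \<open>D\<close> cannot
        follow.\<close>
      have "\<not> D q"
      proof (cases "q = k")
        case True
        then show ?thesis
          using k \<open>q < m\<close> by simp
      next
        case False
        then obtain j where "q = Suc j" "k \<le> j"
          using q by (cases q) auto
        then show ?thesis
          using step(2)[of j] flat[of j] k \<open>q < m\<close> by auto
      qed
      then show "U q"
        using cases[of q] q k \<open>q < m\<close> by auto
    qed
  next
    case (step j)
    then show ?case
      using cases[of "Suc j"] \<open>\<And>j. 1 \<le> j \<Longrightarrow> Suc j < m \<Longrightarrow> \<not> (U j \<and> D (Suc j))\<close>[of j]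
        \<open>\<And>j. 1 \<le> j \<Longrightarrow> Suc j < m \<Longrightarrow> \<not> (U j \<and> N (Suc j))\<close>[of j] q k by auto
  qed
  then show ?thesis
    unfolding valley_def using down flat q k \<open>k \<le> m\<close> \<open>q \<le> m\<close>
    by (intro bexI[of _ k] bexI[of _ "q - k"]) (auto simp: D_def N_def U_def)
qed

lemma weak_BM_independent_iff:
  "weak_BM_independent \<phi> I r A \<longleftrightarrow>
     (\<forall>m i a. m \<ge> 1 \<and> (\<forall>k\<in>{1..m}. i k \<in> I \<and> a k \<in> A (i k)) \<and> alternating i m \<longrightarrow>
        (\<forall>k\<in>{2..m - 1}. peak r i k \<longrightarrow>
           \<phi> (ordered_prod a {1..m}) = \<phi> (a k) * \<phi> (ordered_prod a ({1..m} - {k}))) \<and>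
        (valley r i m \<longrightarrow> \<phi> (ordered_prod a {1..m}) = (\<Prod>j\<in>{1..m}. \<phi> (a j))))"
  unfolding weak_BM_independent_def weak_BM1_def BM2_def peak_def valley_def ..

section \<open>Equivalence of the two notions\<close>

lemma BMT_imp_weak_BM:
  assumes po: "partial_order_on I r" and BMT: "BMT_independent \<phi> I (order_digraph I r) A"
  shows "weak_BM_independent \<phi> I r A"
  unfolding weak_BM_independent_iff
proof (intro allI impI, elim conjE, intro conjI ballI impI)
  fix m i a
  assume m: "1 \<le> m" and ia: "\<forall>k\<in>{1..m}. i k \<in> I \<and> a k \<in> A (i k)" and alt: "alternating i m"
  have fact: "factorizes \<phi> (order_digraph I r) i a {1..m}"
    if "1 \<le> m" "\<And>k. k \<in> {1..m} \<Longrightarrow> i k \<in> I \<and> a k \<in> A (i k)" for m i a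
    using BMT that unfolding BMT_independent_iff_factorizes by blast
  show "\<phi> (ordered_prod a {1..m}) = (\<Prod>j\<in>{1..m}. \<phi> (a j))" if "valley r i m"
    using fact[OF m] factorizes_valley_iff[OF po _ alt that, of \<phi> a] ia by blast
  show "\<phi> (ordered_prod a {1..m}) = \<phi> (a k) * \<phi> (ordered_prod a ({1..m} - {k}))"
    if k: "k \<in> {2..m - 1}" and "peak r i k" for k
  proof -
    \<comment> \<open>Position \<open>k\<close> has neighbours on both sides, so the shortened word
      is nonempty, as the BMT condition requires.\<close>
    have "Suc (m - 1) = m" "k \<in> {1..Suc (m - 1)}" "1 \<le> m - 1"
      using k by auto
    then have "factorizes \<phi> (order_digraph I r) i a ({1..m} - {k})"
      using factorizes_skip[of k "m - 1" i I a A \<phi>] fact[of "m - 1"] ia by metis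
    then show ?thesis
      using factorizes_peak_iff[OF po k _ \<open>peak r i k\<close>, of \<phi> a] fact[OF m] ia by blast
  qed
qed

text \<open>Equal neighbours share a block, and their letters multiply to one letter of the same
  subalgebra. Closure under multiplication enters here.\<close>

lemma factorizes_merge:
  fixes k n :: nat
  assumes k: "k \<in> {1..n}" and eq: "i k = i (Suc k)"
    and mult: "\<And>i x y. i \<in> I \<Longrightarrow> x \<in> A i \<Longrightarrow> y \<in> A i \<Longrightarrow> x * y \<in> A i"
    and I: "\<And>x. x \<in> {1..Suc n} \<Longrightarrow> i x \<in> I \<and> a x \<in> A (i x)"
    and fact: "\<And>i a. (\<And>x. x \<in> {1..n} \<Longrightarrow> i x \<in> I \<and> a x \<in> A (i x)) \<Longrightarrow> factorizes \<phi> E i a {1..n}"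
  shows "factorizes \<phi> E i a {1..Suc n}"
proof -
  let ?S = "{1..Suc n}"
  \<comment> \<open>\<open>p\<close> identifies \<open>k\<close> with \<open>Suc k\<close> and
    shifts later positions down by one; \<open>j\<close> and \<open>b\<close> are the indices and
    letters of the merged word.\<close>
  define p where "p = (\<lambda>x. if x \<le> k then x else x - 1)"
  define j where "j = (\<lambda>y. if y \<le> k then i y else i (Suc y))"
  define b where "b = (\<lambda>y. ordered_prod a {x \<in> ?S. p x = y})"
  have image: "p ` ?S = {1..n}"
  proof
    show "p ` ?S \<subseteq> {1..n}"
      using k by (auto simp: p_def)
    show "{1..n} \<subseteq> p ` ?S"
    proof
      fix y assume "y \<in> {1..n}"
      then show "y \<in> p ` ?S"
        by (cases "y \<le> k") (auto simp: p_def image_iff intro: bexI[of _ y] bexI[of _ "Suc y"])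
    qed
  qed
  have "j y \<in> I \<and> b y \<in> A (j y)" if y: "y \<in> {1..n}" for y
  proof (cases y k rule: linorder_cases)
    case less
    then have "{x \<in> ?S. p x = y} = {y}"
      using y by (auto simp: p_def)
    then show ?thesis
      using less y I[of y] by (simp add: b_def j_def)
  next
    case equal
    then have fibre: "{x \<in> ?S. p x = y} = {k} \<union> {Suc k}"
      using k by (auto simp: p_def)
    have "b y = a k * a (Suc k)"
      unfolding b_def fibre by (subst ordered_prod_Un) auto
    then show ?thesis
      using equal k eq I[of k] I[of "Suc k"] mult by (simp add: j_def)
  next
    case greater
    then have "{x \<in> ?S. p x = y} = {Suc y}"
      using y by (auto simp: p_def)
    then show ?thesis
      using greater y I[of "Suc y"] by (simp add: b_def j_def)
  qed
  then have "factorizes \<phi> E j b (p ` ?S)"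
    unfolding image by (rule fact)
  moreover have "i x = j (p x)" if "x \<in> ?S" for x
  proof -
    consider "x \<le> k" | "x = Suc k" | "Suc k < x"
      by linarith
    then show ?thesis
      by cases (use eq in \<open>auto simp: p_def j_def\<close>)
  qed
  moreover have "mono_on ?S p"
    by (auto simp: mono_on_def p_def)
  ultimately show ?thesis
    using factorizes_pullback[of ?S p i j b a \<phi> E] by (simp add: b_def)
qed

text \<open>The induction on the length runs over all words at once, because merging and deletion
  change both indices and letters.\<close>

lemma weak_BM_imp_BMT:
  assumes po: "partial_order_on I r"
    and mult: "\<And>i x y. i \<in> I \<Longrightarrow> x \<in> A i \<Longrightarrow> y \<in> A i \<Longrightarrow> x * y \<in> A i"
    and BM: "weak_BM_independent \<phi> I r A"
  shows "BMT_independent \<phi> I (order_digraph I r) A"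
proof -
  let ?E = "order_digraph I r"
  have "factorizes \<phi> ?E i a {1..m}"
    if "1 \<le> m" "\<And>x. x \<in> {1..m} \<Longrightarrow> i x \<in> I \<and> a x \<in> A (i x)" for m i a
    using that
  proof (induction m arbitrary: i a)
    case 0
    then show ?case by simp
  next
    case (Suc n)
    note ia = Suc.prems(2)
    show ?case
    proof (cases "alternating i (Suc n)")
      case False
      then obtain k where k: "k \<in> {1..n}" "i k = i (Suc k)"
        unfolding alternating_def by fastforce
      show ?thesis
        \<comment> \<open>Since \<open>k\<close> lies in \<open>{1..n}\<close>, the length
          \<open>n\<close> is positive, as the induction hypothesis demands.\<close>
        by (rule factorizes_merge[OF k mult ia]) (use k Suc.IH in auto)
    next
      case alt: True
      have BM_ia:
        "k \<in> {2..Suc n - 1} \<Longrightarrow> peak r i k \<Longrightarrow>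
          \<phi> (ordered_prod a {1..Suc n}) = \<phi> (a k) * \<phi> (ordered_prod a ({1..Suc n} - {k}))"
        "valley r i (Suc n) \<Longrightarrow> \<phi> (ordered_prod a {1..Suc n}) = (\<Prod>j\<in>{1..Suc n}. \<phi> (a j))" for k
        using BM[unfolded weak_BM_independent_iff, rule_format, of "Suc n" i a] ia alt by auto
      show ?thesis
      proof (cases "\<exists>k\<in>{2..Suc n - 1}. peak r i k")
        case True
        then obtain k where k: "k \<in> {2..Suc n - 1}" "peak r i k"
          by blast
        have "factorizes \<phi> ?E i a ({1..Suc n} - {k})"
          by (rule factorizes_skip[where I = I and A = A]) (use k ia Suc.IH in auto)
        then show ?thesis
          using factorizes_peak_iff[OF po k(1) _ k(2), of \<phi> a] ia BM_ia(1)[OF k] by blast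
      next
        case False
        \<comment> \<open>Words of length one also arrive here, having no interior position and
          hence no peak; they need no induction hypothesis.\<close>
        then have "valley r i (Suc n)"
          using no_peak_imp_valley[OF _ alt] by auto
        then show ?thesis
          using factorizes_valley_iff[OF po _ alt, of \<phi> a] ia BM_ia(2) by blast
      qed
    qed
  qed
  then show ?thesis
    unfolding BMT_independent_iff_factorizes by blast
qed

theorem theorem3p9:
  fixes scale :: "complex \<Rightarrow> 'a::ring_1 \<Rightarrow> 'a"
    and \<phi> :: "'a \<Rightarrow> complex"
    and I :: "'i set"
    and r :: "('i \<times> 'i) set"
    and A :: "'i \<Rightarrow> 'a set"
  assumes "partial_order_on I r"
    and "nc_prob_space scale \<phi>"
    and "\<forall>i\<in>I. complex_unital_algebra.subalgebra scale (A i)"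
  shows "BMT_independent \<phi> I (order_digraph I r) A \<longleftrightarrow> weak_BM_independent \<phi> I r A"
proof -
  have "complex_unital_algebra scale"
    using assms(2) by (simp add: nc_prob_space_def)
  then have "x * y \<in> A i" if "i \<in> I" "x \<in> A i" "y \<in> A i" for i x y
    using assms(3) that by (auto simp: complex_unital_algebra.subalgebra_def)
  then show ?thesis
    using BMT_imp_weak_BM[OF assms(1)] weak_BM_imp_BMT[OF assms(1)] by blast
qed

end
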